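(* Let $g\ge1$. Then $$Sp(\mathbb{Z}_2,2g)=\bigcup_{Y\in\alpha_0}\left[T_Y^{-1}\,Sp_0\,T_Y\right]\ \cup\ \bigcup_{Y\in\alpha_1}\left[T_Y^{-1}\,Sp_1\,T_Y\right].$$
   Context: $\mathbb{Z}_2^{2g}$ carries the standard symplectic form "$.$" with canonical basis $e_1,\dots,e_{2g}$ satisfying $e_{2i-1}.e_{2i}=e_{2i}.e_{2i-1}=1$ and all other products $0$. $Sp(\mathbb{Z}_2,2g)$ is its group of symplectic automorphisms. For $x=(x_1,\dots,x_{2g})\in\mathbb{Z}_2^{2g}$ put $\omega_0(x)=\sum_{k=1}^g x_{2k-1}x_{2k}$ and $\omega_1(x)=\omega_0(x)+x_1+x_2$. For $i=0,1$, $Sp_i$ is the subgroup of those $f\in Sp(\mathbb{Z}_2,2g)$ with $\omega_i\circ f=\omega_i$, and $\alpha_i=\{Y\in\mathbb{Z}_2^{2g}\mid\omega_i(Y)=0\}$. $T_Y$ is the symplectic transvection $T_Y(x)=x+(Y.x)Y$. *)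

theory Defs
  imports "Jordan_Normal_Form.Matrix" "HOL-Library.Z2" "HOL-Algebra.Bij" "HOL-Algebra.Coset"
begin

text \<open>Vectors are indexed from 0, so the coordinate \<open>x\<^sub>i\<close> of the usual 1-based
  notation is \<open>x $ (i - 1)\<close> here, and the pair \<open>(x\<^sub>2\<^sub>k\<^sub>-\<^sub>1, x\<^sub>2\<^sub>k)\<close> with \<open>1 \<le> k \<le> g\<close> is
  \<open>(x $ (2 * k), x $ (2 * k + 1))\<close> with \<open>k < g\<close>.\<close>

abbreviation V :: "nat \<Rightarrow> bit vec set" where
  "V g \<equiv> carrier_vec (2 * g)"

definition symp_form :: "nat \<Rightarrow> bit vec \<Rightarrow> bit vec \<Rightarrow> bit" where
  "symp_form g x y =
     (\<Sum>k<g. x $ (2 * k) * y $ (2 * k + 1) + x $ (2 * k + 1) * y $ (2 * k))"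

definition linear_on_V :: "nat \<Rightarrow> (bit vec \<Rightarrow> bit vec) \<Rightarrow> bool" where
  "linear_on_V g f \<longleftrightarrow>
     (\<forall>x\<in>V g. \<forall>y\<in>V g. f (x + y) = f x + f y) \<and>
     (\<forall>c. \<forall>x\<in>V g. f (c \<cdot>\<^sub>v x) = c \<cdot>\<^sub>v f x)"

definition symp_auts :: "nat \<Rightarrow> (bit vec \<Rightarrow> bit vec) set" where
  "symp_auts g = {f \<in> Bij (V g). linear_on_V g f \<and>
     (\<forall>x\<in>V g. \<forall>y\<in>V g. symp_form g (f x) (f y) = symp_form g x y)}"

text \<open>As in \<^const>\<open>BijGroup\<close>, maps are extensional (\<open>undefined\<close> outside \<open>V g\<close>) and
  the product of \<open>f\<close> and \<open>h\<close> is \<open>f \<circ> h\<close> restricted to \<open>V g\<close>.\<close>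

definition Sp :: "nat \<Rightarrow> (bit vec \<Rightarrow> bit vec) monoid" where
  "Sp g = (BijGroup (V g))\<lparr>carrier := symp_auts g\<rparr>"

definition omega0 :: "nat \<Rightarrow> bit vec \<Rightarrow> bit" where
  "omega0 g x = (\<Sum>k<g. x $ (2 * k) * x $ (2 * k + 1))"

definition omega1 :: "nat \<Rightarrow> bit vec \<Rightarrow> bit" where
  "omega1 g x = omega0 g x + x $ 0 + x $ 1"

definition Sp0 :: "nat \<Rightarrow> (bit vec \<Rightarrow> bit vec) set" where
  "Sp0 g = {f \<in> carrier (Sp g). \<forall>x\<in>V g. omega0 g (f x) = omega0 g x}"

definition Sp1 :: "nat \<Rightarrow> (bit vec \<Rightarrow> bit vec) set" where
  "Sp1 g = {f \<in> carrier (Sp g). \<forall>x\<in>V g. omega1 g (f x) = omega1 g x}"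

definition alpha0 :: "nat \<Rightarrow> bit vec set" where
  "alpha0 g = {Y \<in> V g. omega0 g Y = 0}"

definition alpha1 :: "nat \<Rightarrow> bit vec set" where
  "alpha1 g = {Y \<in> V g. omega1 g Y = 0}"

definition transvection :: "nat \<Rightarrow> bit vec \<Rightarrow> bit vec \<Rightarrow> bit vec" where
  "transvection g Y = (\<lambda>x\<in>V g. x + symp_form g Y x \<cdot>\<^sub>v Y)"

text \<open>\<^const>\<open>symp_form\<close> is the bilinear form with the prescribed values on the canonical basis.\<close>

lemma symp_form_add_left:
  assumes "x \<in> V g" "y \<in> V g" "z \<in> V g"
  shows "symp_form g (x + y) z = symp_form g x z + symp_form g y z"
  using assms unfolding symp_form_def sum.distrib[symmetric]
  by (intro sum.cong) (auto simp: algebra_simps)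

lemma symp_form_smult_left:
  assumes "x \<in> V g" "z \<in> V g"
  shows "symp_form g (c \<cdot>\<^sub>v x) z = c * symp_form g x z"
  using assms unfolding symp_form_def sum_distrib_left
  by (intro sum.cong) (auto simp: algebra_simps)

lemma symp_form_commute: "symp_form g x y = symp_form g y x"
  unfolding symp_form_def by (intro sum.cong) (auto simp: algebra_simps)

lemma symp_form_unit_vec:
  assumes "i < 2 * g" "j < 2 * g"
  shows "symp_form g (unit_vec (2 * g) i) (unit_vec (2 * g) j) =
    (if i div 2 = j div 2 \<and> i \<noteq> j then 1 else 0)"
proof -
  have "symp_form g (unit_vec (2 * g) i) (unit_vec (2 * g) j) =
      (\<Sum>k<g. if k = i div 2 then (if i div 2 = j div 2 \<and> i \<noteq> j then 1 else 0) else 0)"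
    unfolding symp_form_def
  proof (intro sum.cong refl)
    fix k assume k: "k \<in> {..<g}"
    have u: "unit_vec (2 * g) l $ m = (if m = l then 1 else 0 :: bit)"
      if "m < 2 * g" for l m
      using that by (simp add: unit_vec_def)
    have lt: "2 * k < 2 * g" "2 * k + 1 < 2 * g" using k by auto
    have eq: "n = 2 * k \<longleftrightarrow> n div 2 = k \<and> even n" "n = 2 * k + 1 \<longleftrightarrow> n div 2 = k \<and> odd n" for n
      by presburger+
    have neq: "i \<noteq> j \<longleftrightarrow> even i \<noteq> even j" if "i div 2 = j div 2"
      using that by presburger
    show "unit_vec (2 * g) i $ (2 * k) * unit_vec (2 * g) j $ (2 * k + 1) +
          unit_vec (2 * g) i $ (2 * k + 1) * unit_vec (2 * g) j $ (2 * k) =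
          (if k = i div 2 then (if i div 2 = j div 2 \<and> i \<noteq> j then 1 else 0) else 0 :: bit)"
      unfolding u[OF lt(1)] u[OF lt(2)] eq(1)[symmetric]
      using neq eq(1)[of i] eq(1)[of j] eq(2)[of i] eq(2)[of j]
      by (cases "i div 2 = k"; cases "j div 2 = k"; cases "even i"; cases "even j") simp_all
  qed
  also have "\<dots> = (if i div 2 = j div 2 \<and> i \<noteq> j then 1 else 0)"
    using assms by (simp add: less_mult_imp_div_less mult.commute)
  finally show ?thesis .
qed

text \<open>\<^const>\<open>Sp\<close> is a group containing the transvections, so inverses in it are the inverse maps.\<close>

lemma symp_autsD:
  assumes "f \<in> symp_auts g"
  shows "f \<in> Bij (V g)" "linear_on_V g f"
    "\<And>x y. x \<in> V g \<Longrightarrow> y \<in> V g \<Longrightarrow> symp_form g (f x) (f y) = symp_form g x y"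
    "\<And>x. x \<in> V g \<Longrightarrow> f x \<in> V g"
  using assms Bij_imp_funcset[of f "V g"] by (auto simp: symp_auts_def)

lemma subgroup_symp_auts: "subgroup (symp_auts g) (BijGroup (V g))"
proof (rule group.subgroupI[OF group_BijGroup])
  show "symp_auts g \<subseteq> carrier (BijGroup (V g))"
    by (auto simp: symp_auts_def BijGroup_def)
  have "(\<lambda>x\<in>V g. x) \<in> symp_auts g"
    unfolding symp_auts_def using id_Bij[of "V g"] by (auto simp: linear_on_V_def)
  then show "symp_auts g \<noteq> {}" by blast
next
  fix f assume f: "f \<in> symp_auts g"
  note D = symp_autsD[OF f]
  let ?h = "\<lambda>x\<in>V g. inv_into (V g) f x"
  have img: "f ` V g = V g" and inj: "inj_on f (V g)"
    using D(1) by (auto simp: Bij_def bij_betw_def)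
  have hin: "?h x \<in> V g" and fh: "f (?h x) = x" if "x \<in> V g" for x
    using that img by (auto simp: inv_into_into f_inv_into_f)
  have hB: "?h \<in> Bij (V g)" using D(1) by (rule restrict_inv_into_Bij)
  have uniq: "?h x = y" if "y \<in> V g" "f y = x" for x y
    using that D(4) inj by (auto simp: inv_into_f_eq)
  have "linear_on_V g ?h"
    unfolding linear_on_V_def
  proof (intro conjI ballI allI)
    fix x y assume "x \<in> V g" "y \<in> V g"
    then show "?h (x + y) = ?h x + ?h y"
      using D(2) hin fh by (intro uniq) (auto simp: linear_on_V_def simp del: restrict_apply restrict_apply')
  next
    fix c x assume "x \<in> V g"
    then show "?h (c \<cdot>\<^sub>v x) = c \<cdot>\<^sub>v ?h x"
      using D(2) hin fh by (intro uniq) (auto simp: linear_on_V_def simp del: restrict_apply restrict_apply')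
  qed
  moreover have "symp_form g (?h x) (?h y) = symp_form g x y" if "x \<in> V g" "y \<in> V g" for x y
    using D(3)[OF hin[OF that(1)] hin[OF that(2)]] fh[OF that(1)] fh[OF that(2)] by metis
  ultimately show "inv\<^bsub>BijGroup (V g)\<^esub> f \<in> symp_auts g"
    unfolding inv_BijGroup[OF D(1)] symp_auts_def using hB by blast
next
  fix f h assume f: "f \<in> symp_auts g" and h: "h \<in> symp_auts g"
  note F = symp_autsD[OF f] and H = symp_autsD[OF h]
  have "compose (V g) f h \<in> symp_auts g"
    unfolding symp_auts_def
    using compose_Bij[OF F(1) H(1)] F(2-4) H(2-4)
    by (auto simp: linear_on_V_def compose_def)
  then show "f \<otimes>\<^bsub>BijGroup (V g)\<^esub> h \<in> symp_auts g"
    using F(1) H(1) by (simp add: BijGroup_def)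
qed

lemma group_Sp: "group (Sp g)"
  unfolding Sp_def by (rule subgroup.subgroup_is_group[OF subgroup_symp_auts group_BijGroup])

lemma transvection_in_Sp:
  assumes Y: "Y \<in> V g"
  shows "transvection g Y \<in> carrier (Sp g)"
proof -
  let ?T = "transvection g Y"
  have char2: "a + a = 0" for a :: bit
    by (cases a) simp_all
  have T: "?T x = x + symp_form g Y x \<cdot>\<^sub>v Y" "?T x \<in> V g" if "x \<in> V g" for x
    using that Y by (auto simp: transvection_def)
  have add_right: "symp_form g z (x + y) = symp_form g z x + symp_form g z y"
    if "x \<in> V g" "y \<in> V g" "z \<in> V g" for x y z
    using that symp_form_add_left symp_form_commute by metis
  have smult_right: "symp_form g z (c \<cdot>\<^sub>v x) = c * symp_form g z x"
    if "x \<in> V g" "z \<in> V g" for x z c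
    using that symp_form_smult_left symp_form_commute by metis
  have YY: "symp_form g Y Y = 0"
    unfolding symp_form_def by (intro sum.neutral) (auto simp: mult.commute char2)
  have invol: "?T (?T x) = x" if x: "x \<in> V g" for x
  proof -
    have "symp_form g Y (?T x) = symp_form g Y x"
      using x Y by (simp add: T add_right smult_right YY)
    then have "?T (?T x) = (x + symp_form g Y x \<cdot>\<^sub>v Y) + symp_form g Y x \<cdot>\<^sub>v Y"
      using T x by simp
    also have "\<dots> = x"
      using x Y by (intro eq_vecI) (auto simp: add.assoc char2)
    finally show ?thesis .
  qed
  have "bij_betw ?T (V g) (V g)"
    by (rule bij_betw_byWitness[where f' = ?T]) (use invol T in auto)
  then have "?T \<in> Bij (V g)"
    by (simp add: Bij_def transvection_def)
  moreover have "linear_on_V g ?T"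
    unfolding linear_on_V_def using Y
    by (auto simp: T add_right smult_right intro!: eq_vecI simp: algebra_simps)
  moreover have "symp_form g (?T x) (?T y) = symp_form g x y"
    if x: "x \<in> V g" and y: "y \<in> V g" for x y
  proof -
    define a b where "a = symp_form g Y x" and "b = symp_form g Y y"
    have "symp_form g (?T x) (?T y) = symp_form g x y + b * symp_form g x Y + a * b"
      using x y Y by (simp add: T add_right smult_right symp_form_add_left symp_form_smult_left
          YY a_def b_def algebra_simps)
    also have "symp_form g x Y = a"
      unfolding a_def by (rule symp_form_commute)
    finally show ?thesis
      by (cases a; cases b; cases "symp_form g x y") simp_all
  qed
  ultimately show ?thesis
    by (simp add: Sp_def symp_auts_def)
qed

end

theory Submission imports Defs begin

text \<open>
  The conjugate of the stabilizer of a function \<open>q\<close> by \<open>T\<close> is the stabilizer of \<open>q \<circ> T\<close>.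
  The functions \<open>\<omega>\<^sub>0\<close> and \<open>\<omega>\<^sub>1\<close> are quadratic forms whose polarization is the symplectic
  form, and for such a form \<open>q\<close> with \<open>q Y = 0\<close> the transvection \<open>T\<^sub>Y\<close> moves \<open>q\<close> to
  \<open>q + (Y . -)\<close> (\<open>refinement_transvection\<close>). The forms with this polarization are exactly the
  \<open>\<omega>\<^sub>0 + (Z . -)\<close>, and each of them is of one of the shapes just found: if \<open>\<omega>\<^sub>0 Z = 0\<close> take
  \<open>Y = Z\<close>; if \<open>\<omega>\<^sub>0 Z = 1\<close>, write \<open>\<omega>\<^sub>1 = \<omega>\<^sub>0 + (d . -)\<close> with \<open>d = e\<^sub>1 + e\<^sub>2\<close>, so that
  \<open>\<omega>\<^sub>0 + (Z . -) = \<omega>\<^sub>1 + (Y . -)\<close> for \<open>Y = Z + d\<close>, and \<open>\<omega>\<^sub>1 Y = \<omega>\<^sub>0 Z + \<omega>\<^sub>0 d = 0\<close>.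

  So the theorem says that every symplectic automorphism \<open>f\<close> fixes some quadratic form
  \<open>\<omega>\<^sub>0 + (Z . -)\<close> (\<open>exists_invariant_refinement\<close>). The condition on \<open>Z\<close> is
  \<open>\<omega>\<^sub>0 (f x) + \<omega>\<^sub>0 x = Z . (f x + x)\<close> for all \<open>x\<close>. The left-hand side is linear in \<open>x\<close>, because
  \<open>\<omega>\<^sub>0 \<circ> f\<close> and \<open>\<omega>\<^sub>0\<close> have the same polarization, and it vanishes where \<open>f x + x = 0\<close>, because
  there \<open>f x = x\<close>. A linear functional that vanishes on the kernel of a linear map factors
  through this map (\<open>functional_factors_through\<close>), and the form is nondegenerate, so \<open>Z\<close> exists.
\<close>

section \<open>Factoring a linear functional\<close>

text \<open>The covector \<open>z\<close> is built one coordinate at a time: the induction is on the number \<open>k\<close> of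
  leading coordinates in which \<open>A x\<close> may be nonzero. This treats the extension of the functional
  from the range of \<open>A\<close> and its representation by a vector in one step. The case \<open>k = 0\<close> is
  the kernel condition.\<close>

lemma functional_factors_through:
  fixes A :: "'a :: field vec \<Rightarrow> 'a vec" and L :: "'a vec \<Rightarrow> 'a"
  assumes A: "\<And>x. x \<in> carrier_vec n \<Longrightarrow> A x \<in> carrier_vec m"
    and A_lin: "\<And>x y c. x \<in> carrier_vec n \<Longrightarrow> y \<in> carrier_vec n \<Longrightarrow>
      A (x + c \<cdot>\<^sub>v y) = A x + c \<cdot>\<^sub>v A y"
    and L_lin: "\<And>x y c. x \<in> carrier_vec n \<Longrightarrow> y \<in> carrier_vec n \<Longrightarrow>
      L (x + c \<cdot>\<^sub>v y) = L x + c * L y"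
    and ker: "\<And>x. x \<in> carrier_vec n \<Longrightarrow> A x = 0\<^sub>v m \<Longrightarrow> L x = 0"
  shows "\<exists>z\<in>carrier_vec m. \<forall>x\<in>carrier_vec n. L x = z \<bullet> A x"
proof -
  have "\<exists>z\<in>carrier_vec m. \<forall>x\<in>carrier_vec n.
      (\<forall>i. k \<le> i \<and> i < m \<longrightarrow> A x $ i = 0) \<longrightarrow> L x = z \<bullet> A x" if "k \<le> m" for k
    using that
  proof (induction k)
    case 0
    have "L x = 0\<^sub>v m \<bullet> A x" if x: "x \<in> carrier_vec n" and "\<forall>i<m. A x $ i = 0" for x
    proof -
      have "A x = 0\<^sub>v m" using that A[OF x] by (intro eq_vecI) auto
      then show ?thesis using ker[OF x] by simp
    qed
    then show ?case by (intro bexI[of _ "0\<^sub>v m"]) auto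
  next
    case (Suc k)
    then obtain z where z: "z \<in> carrier_vec m"
      and IH: "\<And>x. x \<in> carrier_vec n \<Longrightarrow> (\<And>i. k \<le> i \<Longrightarrow> i < m \<Longrightarrow> A x $ i = 0) \<Longrightarrow>
        L x = z \<bullet> A x"
      by (meson Suc_leD)
    have k: "k < m" using Suc.prems by simp
    show ?case
    proof (cases "\<exists>x0\<in>carrier_vec n. (\<forall>i. Suc k \<le> i \<and> i < m \<longrightarrow> A x0 $ i = 0) \<and> A x0 $ k \<noteq> 0")
      case False
      have "L x = z \<bullet> A x"
        if "x \<in> carrier_vec n" "\<forall>i. Suc k \<le> i \<and> i < m \<longrightarrow> A x $ i = 0" for x
      proof (rule IH[OF that(1)])
        have "A x $ k = 0" using that False by blast
        then show "A x $ i = 0" if "k \<le> i" "i < m" for i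
          using that \<open>\<forall>i. Suc k \<le> i \<and> i < m \<longrightarrow> A x $ i = 0\<close> by (cases "i = k") auto
      qed
      then show ?thesis using z by blast
    next
      case True
      then obtain x0 where x0: "x0 \<in> carrier_vec n" and
        supp0: "\<And>i. Suc k \<le> i \<Longrightarrow> i < m \<Longrightarrow> A x0 $ i = 0" and nz: "A x0 $ k \<noteq> 0"
        by blast
      \<comment> \<open>The new coordinate of the covector is forced by its value at \<open>x0\<close>; subtracting a
        multiple of \<open>x0\<close> clears coordinate \<open>k\<close> of any other vector.\<close>
      define c where "c = (L x0 - z \<bullet> A x0) / A x0 $ k"
      define z' where "z' = z + c \<cdot>\<^sub>v unit_vec m k"
      have z': "z' \<in> carrier_vec m" using z by (simp add: z'_def)
      have z'_prod: "z' \<bullet> v = z \<bullet> v + c * v $ k" if "v \<in> carrier_vec m" for v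
        using that z k by (simp add: z'_def add_scalar_prod_distrib[of _ m])
      have "L x = z' \<bullet> A x"
        if x: "x \<in> carrier_vec n" and supp: "\<forall>i. Suc k \<le> i \<and> i < m \<longrightarrow> A x $ i = 0" for x
      proof -
        define b where "b = - (A x $ k / A x0 $ k)"
        note [simp] = A[OF x] A[OF x0]
        have dims: "dim_vec (A x) = m" "dim_vec (A x0) = m"
          using A[OF x] A[OF x0] by auto
        have Ay: "A (x + b \<cdot>\<^sub>v x0) = A x + b \<cdot>\<^sub>v A x0"
          using A_lin x x0 by blast
        have "A (x + b \<cdot>\<^sub>v x0) $ i = 0" if "k \<le> i" "i < m" for i
          unfolding Ay using that supp supp0[of i] nz
          by (cases "i = k") (auto simp: b_def dims)
        then have "L (x + b \<cdot>\<^sub>v x0) = z \<bullet> (A x + b \<cdot>\<^sub>v A x0)"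
          using IH[of "x + b \<cdot>\<^sub>v x0"] x x0 by (simp add: Ay)
        then have "L x + b * L x0 = z \<bullet> A x + b * (z \<bullet> A x0)"
          using x x0 z by (simp add: L_lin scalar_prod_add_distrib[of _ m])
        then have "L x = z \<bullet> A x + (- b) * (L x0 - z \<bullet> A x0)"
          by (simp add: algebra_simps eq_diff_eq)
        also have "(- b) * (L x0 - z \<bullet> A x0) = c * A x $ k"
          by (simp add: b_def c_def)
        finally show ?thesis by (simp add: z'_prod)
      qed
      then show ?thesis using z' by blast
    qed
  qed
  from this[OF order_refl] show ?thesis by (meson leD)
qed

section \<open>The symplectic form\<close>

lemma symp_form_add_right:
  assumes "x \<in> V g" "y \<in> V g" "z \<in> V g"
  shows "symp_form g z (x + y) = symp_form g z x + symp_form g z y"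
  using assms symp_form_add_left symp_form_commute by metis

lemma symp_form_smult_right:
  assumes "x \<in> V g" "z \<in> V g"
  shows "symp_form g z (c \<cdot>\<^sub>v x) = c * symp_form g z x"
  using assms symp_form_smult_left symp_form_commute by metis

lemma symp_form_self: "symp_form g x x = 0"
  unfolding symp_form_def by (intro sum.neutral) (auto simp: mult.commute)

text \<open>Nondegeneracy: swapping the two coordinates of each hyperbolic pair turns the symplectic
  form into the standard scalar product.\<close>

lemma scalar_prod_eq_symp_form:
  assumes z: "z \<in> V g"
  shows "\<exists>y\<in>V g. \<forall>x\<in>V g. z \<bullet> x = symp_form g y x"
proof -
  define y where "y = vec (2 * g) (\<lambda>i. z $ (if even i then i + 1 else i - 1))"
  have "z \<bullet> x = symp_form g y x" if x: "x \<in> V g" for x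
  proof -
    have pairs: "(\<Sum>i<2 * n. h i) = (\<Sum>k<n. h (2 * k) + h (2 * k + 1))"
      for h :: "nat \<Rightarrow> bit" and n
    proof (induction n)
      case (Suc n)
      have "2 * Suc n = Suc (Suc (2 * n))" by simp
      then show ?case
        by (simp only: sum.lessThan_Suc Suc.IH add.assoc Suc_eq_plus1[of "2 * n", symmetric])
    qed simp
    have "z \<bullet> x = (\<Sum>i<2 * g. z $ i * x $ i)"
      using x by (simp add: scalar_prod_def atLeast0LessThan)
    also have "\<dots> = symp_form g y x"
      unfolding pairs symp_form_def
      by (intro sum.cong) (auto simp: y_def algebra_simps)
    finally show ?thesis .
  qed
  then show ?thesis by (intro bexI[of _ y]) (auto simp: y_def)
qed

section \<open>Quadratic refinements of the symplectic form\<close>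

text \<open>Over the field with two elements the polarization identity alone makes \<open>q\<close> a quadratic
  form: homogeneity \<open>q (c x) = c\<^sup>2 q x\<close> says no more than \<open>q 0 = 0\<close>.\<close>

definition quadratic_refinement :: "nat \<Rightarrow> (bit vec \<Rightarrow> bit) \<Rightarrow> bool" where
  "quadratic_refinement g q \<longleftrightarrow>
     (\<forall>x\<in>V g. \<forall>y\<in>V g. q (x + y) = q x + q y + symp_form g x y)"

lemma refinement_add:
  assumes "quadratic_refinement g q" "x \<in> V g" "y \<in> V g"
  shows "q (x + y) = q x + q y + symp_form g x y"
  using assms by (simp add: quadratic_refinement_def)

lemma refinement_smult:
  assumes "quadratic_refinement g q" "x \<in> V g"
  shows "q (c \<cdot>\<^sub>v x) = c * q x"
proof (cases c)
  case zero
  have "q (0\<^sub>v (2 * g) + 0\<^sub>v (2 * g)) = q (0\<^sub>v (2 * g)) + q (0\<^sub>v (2 * g))"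
    using refinement_add[OF assms(1), of "0\<^sub>v (2 * g)" "0\<^sub>v (2 * g)"] symp_form_self by simp
  then have "q (0\<^sub>v (2 * g)) = 0" by simp
  moreover have "0 \<cdot>\<^sub>v x = 0\<^sub>v (2 * g)" using assms(2) by (intro eq_vecI) auto
  ultimately show ?thesis using zero by simp
qed simp

text \<open>Both \<open>q ((Y . x) Y) = (Y . x)\<^sup>2 q Y\<close> and the polarization term \<open>(Y . x)\<^sup>2\<close> arise; the first
  is zero, and squaring is the identity on the field with two elements.\<close>

lemma refinement_transvection:
  assumes q: "quadratic_refinement g q" and Y: "Y \<in> V g" "q Y = 0" and x: "x \<in> V g"
  shows "q (transvection g Y x) = q x + symp_form g Y x"
proof -
  define a where "a = symp_form g Y x"
  have "q (transvection g Y x) = q (x + a \<cdot>\<^sub>v Y)"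
    using x by (simp add: transvection_def a_def)
  also have "\<dots> = q x + a * a"
    using q Y x symp_form_commute[of g x Y]
    by (simp add: refinement_add refinement_smult symp_form_smult_right a_def)
  also have "a * a = a" by (cases a) simp_all
  finally show ?thesis by (simp add: a_def)
qed

lemma refinement_omega0: "quadratic_refinement g (omega0 g)"
  unfolding quadratic_refinement_def omega0_def symp_form_def sum.distrib[symmetric]
proof (intro ballI sum.cong refl)
  fix x y :: "bit vec" and k assume "x \<in> V g" "y \<in> V g" "k \<in> {..<g}"
  then have "(x + y) $ (2 * k) = x $ (2 * k) + y $ (2 * k)"
    "(x + y) $ (2 * k + 1) = x $ (2 * k + 1) + y $ (2 * k + 1)" by auto
  then show "(x + y) $ (2 * k) * (x + y) $ (2 * k + 1) =
      x $ (2 * k) * x $ (2 * k + 1) + y $ (2 * k) * y $ (2 * k + 1) +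
      (x $ (2 * k) * y $ (2 * k + 1) + x $ (2 * k + 1) * y $ (2 * k))"
    by (simp only: distrib_left distrib_right ac_simps)
qed

lemma refinement_omega1:
  assumes "g \<ge> 1"
  shows "quadratic_refinement g (omega1 g)"
  unfolding quadratic_refinement_def
proof (intro ballI)
  fix x y assume xy: "x \<in> V g" "y \<in> V g"
  then have "(x + y) $ 0 = x $ 0 + y $ 0" "(x + y) $ 1 = x $ 1 + y $ 1"
    using assms by auto
  then show "omega1 g (x + y) = omega1 g x + omega1 g y + symp_form g x y"
    by (simp only: omega1_def refinement_add[OF refinement_omega0 xy] ac_simps)
qed

text \<open>Here \<open>d = e\<^sub>1 + e\<^sub>2\<close>. The value \<open>\<omega>\<^sub>0 d = 1\<close> is what lets \<open>\<omega>\<^sub>1\<close> take over for those \<open>Z\<close>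
  with \<open>\<omega>\<^sub>0 Z = 1\<close>.\<close>

lemma omega1_eq_omega0_plus_form:
  assumes "g \<ge> 1"
  obtains d where "d \<in> V g" "omega0 g d = 1" "\<And>x. omega1 g x = omega0 g x + symp_form g d x"
proof -
  obtain n where n: "g = Suc n" using assms by (cases g) auto
  define d :: "bit vec" where "d = vec (2 * g) (\<lambda>i. if i < 2 then 1 else 0)"
  have "omega0 g d = 1"
    unfolding omega0_def n sum.lessThan_Suc_shift by (simp add: d_def n)
  moreover have "symp_form g d x = x $ 0 + x $ 1" for x
    unfolding symp_form_def n sum.lessThan_Suc_shift
    by (cases "x $ 0"; cases "x $ 1") (simp_all add: d_def n)
  ultimately show ?thesis
    by (intro that[of d]) (simp_all only: omega1_def add.assoc d_def vec_carrier)
qed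

section \<open>Invariant refinements\<close>

lemma exists_invariant_refinement:
  assumes f: "f \<in> symp_auts g" and q: "quadratic_refinement g q"
  shows "\<exists>Z\<in>V g. \<forall>x\<in>V g. q (f x) + symp_form g Z (f x) = q x + symp_form g Z x"
proof -
  note F = symp_autsD[OF f]
  define A where "A x = f x + x" for x
  define L where "L x = q (f x) + q x" for x
  have f_lin: "f (x + c \<cdot>\<^sub>v y) = f x + c \<cdot>\<^sub>v f y" if "x \<in> V g" "y \<in> V g" for x y c
    using that F(2) by (simp add: linear_on_V_def)
  have "\<exists>z\<in>V g. \<forall>x\<in>V g. L x = z \<bullet> A x"
  proof (rule functional_factors_through)
    fix x y :: "bit vec" and c assume xy: "x \<in> V g" "y \<in> V g"
    show "A (x + c \<cdot>\<^sub>v y) = A x + c \<cdot>\<^sub>v A y"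
      using xy F(4)[of x] F(4)[of y]
      by (intro eq_vecI) (auto simp: A_def f_lin algebra_simps)
    \<comment> \<open>The two polarization terms are equal and cancel in characteristic 2.\<close>
    show "L (x + c \<cdot>\<^sub>v y) = L x + c * L y"
    proof -
      define a where "a = symp_form g x y"
      have "q (f (x + c \<cdot>\<^sub>v y)) = q (f x) + c * q (f y) + c * a"
        using xy F(4) q
        by (simp only: f_lin refinement_add refinement_smult symp_form_smult_right F(3) a_def
            smult_carrier_vec)
      moreover have "q (x + c \<cdot>\<^sub>v y) = q x + c * q y + c * a"
        using xy q
        by (simp only: refinement_add refinement_smult symp_form_smult_right a_def smult_carrier_vec)
      ultimately show ?thesis
        unfolding L_def
        by (cases c; cases a; cases "q (f x)"; cases "q (f y)"; cases "q x"; cases "q y")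
          simp_all
    qed
  next
    fix x assume x: "x \<in> V g" and "A x = 0\<^sub>v (2 * g)"
    then have "(f x + x) $ i = 0" if "i < 2 * g" for i
      using that by (simp add: A_def)
    then have "f x $ i = x $ i" if "i < 2 * g" for i
      using that x F(4)[OF x] by (cases "f x $ i"; cases "x $ i") fastforce+
    then have "f x = x" using x F(4)[OF x] by (intro eq_vecI) auto
    then show "L x = 0" by (simp add: L_def)
  qed (use F(4) in \<open>auto simp: A_def\<close>)
  then obtain Z where Z: "Z \<in> V g" and LZ: "\<And>x. x \<in> V g \<Longrightarrow> L x = symp_form g Z (A x)"
    using scalar_prod_eq_symp_form[of _ g] F(4) unfolding A_def
    by (metis add_carrier_vec)
  have "q (f x) + symp_form g Z (f x) = q x + symp_form g Z x" if x: "x \<in> V g" for x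
  proof -
    have "q (f x) + q x = symp_form g Z (f x) + symp_form g Z x"
      using LZ[OF x] Z x F(4)[OF x] by (simp add: L_def A_def symp_form_add_right)
    then show ?thesis
      by (cases "q (f x)"; cases "q x"; cases "symp_form g Z (f x)"; cases "symp_form g Z x")
        simp_all
  qed
  then show ?thesis using Z by blast
qed

section \<open>Conjugates of stabilizers\<close>

lemma mult_Sp_apply:
  assumes "f \<in> carrier (Sp g)" "h \<in> carrier (Sp g)" "x \<in> V g"
  shows "(f \<otimes>\<^bsub>Sp g\<^esub> h) x = f (h x)"
  using assms by (simp add: Sp_def BijGroup_def symp_auts_def compose_def)

lemma carrier_Sp_closed:
  assumes "f \<in> carrier (Sp g)" "x \<in> V g"
  shows "f x \<in> V g"
  using assms symp_autsD(4) by (simp add: Sp_def)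

lemma mem_conjugate_stabilizer:
  assumes f: "f \<in> carrier (Sp g)" and T: "T \<in> carrier (Sp g)"
    and stab: "\<And>x. x \<in> V g \<Longrightarrow> q (T (f x)) = q (T x)"
  shows "f \<in> (inv\<^bsub>Sp g\<^esub> T <#\<^bsub>Sp g\<^esub> {h \<in> carrier (Sp g). \<forall>x\<in>V g. q (h x) = q x}) #>\<^bsub>Sp g\<^esub> T"
proof -
  interpret group "Sp g" by (rule group_Sp)
  define h where "h = T \<otimes>\<^bsub>Sp g\<^esub> f \<otimes>\<^bsub>Sp g\<^esub> inv\<^bsub>Sp g\<^esub> T"
  have h: "h \<in> carrier (Sp g)" using f T by (simp add: h_def)
  have hT: "h \<otimes>\<^bsub>Sp g\<^esub> T = T \<otimes>\<^bsub>Sp g\<^esub> f"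
    using f T by (simp add: h_def m_assoc)
  have "q (h y) = q y" if y: "y \<in> V g" for y
  proof -
    \<comment> \<open>Every vector is of the form \<open>T x\<close>, and \<open>h (T x) = T (f x)\<close>.\<close>
    have "T ` V g = V g"
      using T by (simp add: Sp_def symp_auts_def Bij_def bij_betw_def)
    then obtain x where x: "x \<in> V g" "y = T x"
      using y by blast
    have "h (T x) = T (f x)"
      using mult_Sp_apply[OF h T x(1)] mult_Sp_apply[OF T f x(1)] hT by simp
    then show ?thesis using stab x by simp
  qed
  moreover have "f = inv\<^bsub>Sp g\<^esub> T \<otimes>\<^bsub>Sp g\<^esub> h \<otimes>\<^bsub>Sp g\<^esub> T"
    using f T h hT by (simp add: m_assoc inv_solve_left)
  ultimately show ?thesis
    using h unfolding l_coset_def r_coset_def by blast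
qed

theorem corollary22:
  fixes g :: nat
  assumes "g \<ge> 1"
  shows "carrier (Sp g) =
    (\<Union>Y\<in>alpha0 g.
       (inv\<^bsub>Sp g\<^esub> (transvection g Y) <#\<^bsub>Sp g\<^esub> Sp0 g) #>\<^bsub>Sp g\<^esub> transvection g Y) \<union>
    (\<Union>Y\<in>alpha1 g.
       (inv\<^bsub>Sp g\<^esub> (transvection g Y) <#\<^bsub>Sp g\<^esub> Sp1 g) #>\<^bsub>Sp g\<^esub> transvection g Y)"
  (is "_ = ?U0 \<union> ?U1")
proof
  interpret group "Sp g" by (rule group_Sp)
  show "?U0 \<union> ?U1 \<subseteq> carrier (Sp g)"
    by (auto simp: l_coset_def r_coset_def Sp0_def Sp1_def alpha0_def alpha1_def
        intro!: transvection_in_Sp)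
  show "carrier (Sp g) \<subseteq> ?U0 \<union> ?U1"
  proof
    fix f assume f: "f \<in> carrier (Sp g)"
    note fV = carrier_Sp_closed[OF f]
    have "f \<in> symp_auts g" using f by (simp add: Sp_def)
    then obtain Z where Z: "Z \<in> V g" and inv_Z: "\<And>x. x \<in> V g \<Longrightarrow>
        omega0 g (f x) + symp_form g Z (f x) = omega0 g x + symp_form g Z x"
      using exists_invariant_refinement[OF _ refinement_omega0] by blast
    show "f \<in> ?U0 \<union> ?U1"
    proof (cases "omega0 g Z")
      case zero
      have "omega0 g (transvection g Z (f x)) = omega0 g (transvection g Z x)"
        if "x \<in> V g" for x
        using that fV zero Z inv_Z by (simp add: refinement_transvection[OF refinement_omega0])
      then have "f \<in> (inv\<^bsub>Sp g\<^esub> (transvection g Z) <#\<^bsub>Sp g\<^esub> Sp0 g) #>\<^bsub>Sp g\<^esub> transvection g Z"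
        unfolding Sp0_def by (intro mem_conjugate_stabilizer f transvection_in_Sp Z)
      then show ?thesis using Z zero unfolding alpha0_def by blast
    next
      case one
      obtain d where d: "d \<in> V g" "omega0 g d = 1"
        and omega1: "\<And>x. omega1 g x = omega0 g x + symp_form g d x"
        using omega1_eq_omega0_plus_form[OF assms] by blast
      define Y where "Y = Z + d"
      have Y: "Y \<in> V g" using Z d by (simp add: Y_def)
      have Y0: "omega1 g Y = 0"
        using Z d one symp_form_commute[of g Z d] symp_form_self[of g d]
        by (simp add: Y_def omega1 refinement_add[OF refinement_omega0] symp_form_add_right)
      have "omega1 g (transvection g Y x) = omega0 g x + symp_form g Z x"
        if "x \<in> V g" for x
      proof -
        have "omega1 g (transvection g Y x) = omega1 g x + symp_form g Y x"
          by (rule refinement_transvection[OF refinement_omega1[OF assms] Y Y0 that])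
        also have "symp_form g Y x = symp_form g Z x + symp_form g d x"
          unfolding Y_def by (rule symp_form_add_left[OF Z d(1) that])
        finally show ?thesis
          unfolding omega1 by (cases "symp_form g d x"; cases "symp_form g Z x") simp_all
      qed
      then have "omega1 g (transvection g Y (f x)) = omega1 g (transvection g Y x)"
        if "x \<in> V g" for x
        using that fV inv_Z by simp
      then have "f \<in> (inv\<^bsub>Sp g\<^esub> (transvection g Y) <#\<^bsub>Sp g\<^esub> Sp1 g) #>\<^bsub>Sp g\<^esub> transvection g Y"
        unfolding Sp1_def by (intro mem_conjugate_stabilizer f transvection_in_Sp Y)
      then show ?thesis using Y Y0 unfolding alpha1_def by blast
    qed
  qed
qed

end
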